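(* Let $p\in[1,\infty)$ and $\gamma\in\mathbb{R}$. On the group $G=\mathbb{R}^{n-1}\rtimes\mathbb{R}^+$ endowed with the measure $\mu_\gamma$, suppose that a Poincaré inequality $$\int_{B_r}|f-f_{B_r}|^p\,d\mu_\gamma\le C(r,p)\int_{B_r}|\nabla f|^p\,d\mu_\gamma,\qquad f\in C^\infty(G),$$ holds, where $f_{B_r}=\frac{1}{\mu_\gamma(B_r)}\int_{B_r}f\,d\mu_\gamma$. (i) If $\gamma<-\frac{p+n-1}{2}$, then $$\left|\gamma+\tfrac{p+n-1}{2}\right|+\tfrac{p+n-1}{2}>\left|\gamma+p+\tfrac{n-1}{2}\right|+\tfrac{n-1}{2},$$ and $C(r,p)$ grows exponentially with respect to the radius $r$: with a constant $C>0$ independent of $r$, $$C(r,p)\ge C\,e^{r\left(\left|\gamma+\frac{p+n-1}{2}\right|+\frac{p}{2}-\left|\gamma+p+\frac{n-1}{2}\right|\right)}.$$ (ii) In particular, if $\gamma=-n+1$ (so that $\mu_\gamma$ is a left Haar measure) and $n>p+1$, then, with a constant $C>0$ independent of $r$, $$C(r,p)\ge C\,e^{\left(\left|\frac{-n+p+1}{2}\right|-\left|\frac{-n+1}{2}+p\right|+\frac p2\right)r}=\begin{cases}C\,e^{pr} & \text{if } n\ge 2p+1,\\ C\,e^{(n-p-1)r} & \text{if } p+1<n\le 2p+1.\end{cases}$$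
   Context: $G=\mathbb{R}^{n-1}\rtimes\mathbb{R}^+$ is the "$ax+b$" group of dimension $n$, with elements $(x,a)$, $x\in\mathbb{R}^{n-1}$, $a>0$, and product $(x,a)(x',a')=(x+ax',aa')$. A right Haar measure is $d\rho(x,a)=\frac{dx\,da}{a}$, and a left Haar measure is $d\lambda(x,a)=\frac{dx\,da}{a^n}$. The measure $\mu_\gamma$ is the one with density $a^\gamma$ with respect to $\rho$, i.e. $d\mu_\gamma(x,a)=a^{\gamma-1}\,dx\,da$; in particular $\mu_{1-n}=\lambda$ (the hyperbolic measure). The left-invariant vector fields considered are $X_i=a\partial_{x_i}$ ($i=1,\dots,n-1$) and $X_0=a\partial_a$, and $|\nabla f|^2=\sum_{i=0}^{n-1}(X_if)^2$. The associated left-invariant distance is the hyperbolic metric; the distance $|(x,a)|$ of $(x,a)$ from the identity $(0,1)$ satisfies $\cosh|(x,a)|=\frac12(a+a^{-1}+a^{-1}|x|^2)$, where $|x|$ is the Euclidean norm of $x$. $B_r$ is the ball of radius $r$ centred at the identity: $$B_r=\{(x,a): e^{-r}<a<e^r,\ |x|^2<2a(\cosh r-\cosh\log a)\}.$$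
   Formalization: The lower bounds are stated for all r ≥ r0, for each r0 > 0, with C allowed to depend on r0, since a single C for all r > 0 fails as r → 0 (the best C(r,p) is O(r^p)); also n ≥ 2 is required, since the claim fails for n = 1. *)

theory Defs
  imports "HOL-Analysis.Analysis"
begin

text \<open>
  The group of dimension \<open>n = CARD('m) + 1\<close> is represented on the half-space \<open>a > 0\<close> of
  \<open>\<real>\<^sup>n\<^sup>-\<^sup>1 \<times> \<real>\<close>. As \<open>'m\<close> is nonempty, \<open>n \<ge> 2\<close>. Only its measures, its left-invariant frame
  and its balls about the identity are needed, and these are given in coordinates.
\<close>

definition axb_group :: "((real ^ 'm) \<times> real) set" where
  "axb_group = {(x, a). a > 0}"

definition axb_right_haar :: "((real ^ 'm) \<times> real) measure" where
  "axb_right_haar = density (restrict_space lborel axb_group) (\<lambda>(x, a). ennreal (1 / a))"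

definition axb_left_haar :: "((real ^ 'm) \<times> real) measure" where
  "axb_left_haar =
     density (restrict_space lborel axb_group) (\<lambda>(x, a). ennreal (1 / a ^ (CARD('m) + 1)))"

definition axb_measure :: "real \<Rightarrow> ((real ^ 'm) \<times> real) measure" where
  "axb_measure \<gamma> = density axb_right_haar (\<lambda>(x, a). ennreal (a powr \<gamma>))"

text \<open>Distance from the identity \<open>(0, 1)\<close>; meaningful on the group only.\<close>

definition axb_dist_id :: "(real ^ 'm) \<times> real \<Rightarrow> real" where
  "axb_dist_id = (\<lambda>(x, a). arcosh ((a + inverse a + inverse a * (norm x)\<^sup>2) / 2))"

definition axb_ball :: "real \<Rightarrow> ((real ^ 'm) \<times> real) set" where
  "axb_ball r =
     {(x, a). exp (- r) < a \<and> a < exp r \<and> (norm x)\<^sup>2 < 2 * a * (cosh r - cosh (ln a))}"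

lemma axb_ball_eq_dist:
  fixes r :: real
  assumes "r > 0"
  shows "(axb_ball r :: ((real ^ 'm) \<times> real) set) = {z \<in> axb_group. axb_dist_id z < r}"
proof -
  have "(x, a) \<in> axb_ball r \<longleftrightarrow> (x, a) \<in> axb_group \<and> axb_dist_id (x, a) < r"
    for x :: "real ^ 'm" and a :: real
  proof (cases "a > 0")
    case False
    then have "\<not> exp (- r) < a"
      using exp_gt_zero[of "- r"] by linarith
    with False show ?thesis
      by (simp add: axb_ball_def axb_group_def)
  next
    case True
    define q where "q = (a + inverse a + inverse a * (norm x)\<^sup>2) / 2"
    have ch: "cosh (ln a) = (a + inverse a) / 2"
      using True by (simp add: cosh_ln_real)
    then have q: "q = cosh (ln a) + inverse a * (norm x)\<^sup>2 / 2"
      by (simp add: q_def add_divide_distrib)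
    have "inverse a * (norm x)\<^sup>2 \<ge> 0"
      using True by simp
    then have q1: "q \<ge> 1" "q \<ge> cosh (ln a)"
      using q cosh_real_ge_1[of "ln a"] by auto
    have 1: "arcosh q < r \<longleftrightarrow> q < cosh r"
      using arcosh_less_iff_real[of q "cosh r"] q1(1) cosh_real_ge_1[of r] assms
      by (simp add: arcosh_cosh_real)
    have 2: "q < cosh r \<longleftrightarrow> (norm x)\<^sup>2 < 2 * a * (cosh r - cosh (ln a))"
      unfolding q using True by (simp add: field_simps)
    have 3: "exp (- r) < a \<and> a < exp r" if "q < cosh r"
    proof -
      have "cosh \<bar>ln a\<bar> < cosh r"
        using that q1(2) by simp
      then have "\<bar>ln a\<bar> < r"
        using cosh_real_nonneg_less_iff[of "\<bar>ln a\<bar>" r] assms by simp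
      then have "- r < ln a" "ln a < r"
        by auto
      then show ?thesis
        using True by (metis exp_less_cancel_iff exp_ln)
    qed
    show ?thesis
      using True 1 2 3 by (auto simp: axb_ball_def axb_group_def axb_dist_id_def q_def)
  qed
  then show ?thesis
    by auto
qed

definition axb_X :: "'m \<Rightarrow> ((real ^ 'm) \<times> real \<Rightarrow> real) \<Rightarrow> (real ^ 'm) \<times> real \<Rightarrow> real" where
  "axb_X i f = (\<lambda>z. snd z * frechet_derivative f (at z) (axis i 1, 0))"

definition axb_X0 :: "((real ^ 'm) \<times> real \<Rightarrow> real) \<Rightarrow> (real ^ 'm) \<times> real \<Rightarrow> real" where
  "axb_X0 f = (\<lambda>z. snd z * frechet_derivative f (at z) (0, 1))"

definition axb_grad_norm :: "((real ^ 'm) \<times> real \<Rightarrow> real) \<Rightarrow> (real ^ 'm) \<times> real \<Rightarrow> real" where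
  "axb_grad_norm f z = sqrt ((axb_X0 f z)\<^sup>2 + (\<Sum>i\<in>UNIV. (axb_X i f z)\<^sup>2))"

primrec k_times_cont_diff_on ::
  "nat \<Rightarrow> ('a :: real_normed_vector \<Rightarrow> 'b :: real_normed_vector) \<Rightarrow> 'a set \<Rightarrow> bool" where
  "k_times_cont_diff_on 0 f S \<longleftrightarrow> continuous_on S f"
| "k_times_cont_diff_on (Suc k) f S \<longleftrightarrow>
     (\<forall>z\<in>S. f differentiable (at z)) \<and>
     (\<forall>v. k_times_cont_diff_on k (\<lambda>z. frechet_derivative f (at z) v) S)"

text \<open>Intended for open \<open>S\<close>; the values of \<open>f\<close> outside \<open>S\<close> are then irrelevant.\<close>

definition smooth_fun_on ::
  "('a :: real_normed_vector \<Rightarrow> 'b :: real_normed_vector) \<Rightarrow> 'a set \<Rightarrow> bool" where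
  "smooth_fun_on f S \<longleftrightarrow> (\<forall>k. k_times_cont_diff_on k f S)"

definition axb_avg :: "real \<Rightarrow> real \<Rightarrow> ((real ^ 'm) \<times> real \<Rightarrow> real) \<Rightarrow> real" where
  "axb_avg \<gamma> r f =
     (LINT z:axb_ball r|axb_measure \<gamma>. f z)
       / measure (axb_measure \<gamma>) (axb_ball r :: ((real ^ 'm) \<times> real) set)"

end

(* The test function f(x,a) = tanh x_k is used for every r. As
   2 a (cosh r - cosh (log a)) = (e^r - a)(a - e^-r), the ball contains, for r \<ge> r0, a product of a fixed
   box in x with the interval [u e^-r, v e^-r], and on one of two opposite boxes |f - c| \<ge> tanh \<epsilon>, whatever
   the constant c; this bounds the left-hand side of the Poincare inequality below by a multiple of
   e^(-r \<gamma>). The gradient of f has length a (1 - tanh^2 x_k). The linear function x_k would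
   lose a factor r when \<gamma> + p + (n-1)/2 = 0; here the decay of 1 - tanh^2 yields an additional factor
   R^(-1/2) in the integral over the slice |x| < R with R^2 = a e^r, which makes the integral over a converge. *)
theory Submission
  imports Defs "HOL-Computational_Algebra.Polynomial"
begin

section \<open>Balls and measures in coordinates\<close>

text \<open>In factored form the slice at height a is a Euclidean ball whose squared radius vanishes
  at both ends of the height interval. The lower and upper estimates below treat the two factors
  separately.\<close>

lemma axb_ball_eq:
  "(axb_ball r :: ((real ^ 'm) \<times> real) set)
    = {z. exp (- r) < snd z \<and> snd z < exp r \<and> (norm (fst z))\<^sup>2 < (exp r - snd z) * (snd z - exp (- r))}"
proof -
  have *: "2 * a * (cosh r - cosh (ln a)) = (exp r - a) * (a - exp (- r))" if "exp (- r) < a" for a :: real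
  proof -
    have "a > 0"
      using that exp_gt_zero[of "- r"] by linarith
    then have "2 * a * (cosh r - cosh (ln a)) = a * (exp r + exp (- r)) - a * (a + inverse a)"
      by (simp add: cosh_ln_real cosh_field_def[of r] field_simps)
    also have "\<dots> = (exp r - a) * (a - exp (- r))"
      using \<open>a > 0\<close> by (simp add: algebra_simps flip: exp_add)
    finally show ?thesis .
  qed
  show ?thesis
    unfolding axb_ball_def by (auto simp: *)
qed

lemma axb_ballD:
  assumes "z \<in> axb_ball r"
  shows "exp (- r) < snd z" "snd z < exp r" "0 < snd z"
proof -
  show "exp (- r) < snd z" "snd z < exp r"
    using assms by (auto simp: axb_ball_def)
  then show "0 < snd z"
    using exp_gt_zero[of "- r"] by linarith
qed

lemma axb_ball_subset_group: "axb_ball r \<subseteq> axb_group"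
  using axb_ballD(3) by (force simp: axb_group_def)

lemma open_axb_ball: "open (axb_ball r :: ((real ^ 'm) \<times> real) set)"
  unfolding axb_ball_eq
  by (intro open_Collect_conj open_Collect_less continuous_intros)

lemma open_axb_group: "open (axb_group :: ((real ^ 'm) \<times> real) set)"
proof -
  have *: "axb_group = (UNIV :: (real ^ 'm) set) \<times> {0 :: real<..}"
    by (auto simp: axb_group_def)
  show ?thesis
    unfolding * by (intro open_Times) auto
qed

lemma sets_axb_group [measurable]: "(axb_group :: ((real ^ 'm) \<times> real) set) \<in> sets borel"
  by (simp add: open_axb_group)

lemma sets_axb_ball [measurable]: "(axb_ball r :: ((real ^ 'm) \<times> real) set) \<in> sets borel"
  by (simp add: open_axb_ball)

text \<open>The hypothesis is stated for the product sigma-algebra, where the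
  \<open>measurable\<close> method can decompose functions of \<open>fst\<close> and
  \<open>snd\<close>; \<open>borel_prod\<close> identifies it with the Borel sets of the product
  type.\<close>

lemma borel_measurable_restrict_lborel:
  fixes g :: "(real ^ 'm) \<times> real \<Rightarrow> 'b :: topological_space"
  assumes "g \<in> borel_measurable (borel \<Otimes>\<^sub>M borel)"
  shows "g \<in> borel_measurable (restrict_space lborel A)"
  using assms by (simp add: borel_prod measurable_restrict_space1)

text \<open>The densities 1/a and a^\<gamma> multiply to a single power of a. The two integrands
  need to agree only on the half-space, where a > 0 and the rules for \<open>powr\<close>
  apply.\<close>

lemma axb_measure_eq:
  "(axb_measure \<gamma> :: ((real ^ 'm) \<times> real) measure)
    = density (restrict_space lborel axb_group) (\<lambda>z. ennreal (snd z powr (\<gamma> - 1)))"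
proof -
  let ?M = "restrict_space lborel axb_group :: ((real ^ 'm) \<times> real) measure"
  have m1: "(\<lambda>z. ennreal (1 / snd z)) \<in> borel_measurable ?M"
    by (rule borel_measurable_restrict_lborel) measurable
  have m2: "(\<lambda>z. ennreal (snd z powr \<delta>)) \<in> borel_measurable ?M" for \<delta>
    by (rule borel_measurable_restrict_lborel) measurable
  have "axb_measure \<gamma> = density ?M (\<lambda>z. ennreal (1 / snd z) * ennreal (snd z powr \<gamma>))"
    unfolding axb_measure_def axb_right_haar_def case_prod_beta by (intro density_density_eq m1 m2)
  also have "\<dots> = density ?M (\<lambda>z. ennreal (snd z powr (\<gamma> - 1)))"
  proof (intro density_cong AE_I2)
    fix z assume "z \<in> space ?M"
    then have "snd z > 0"
      by (auto simp: space_restrict_space axb_group_def)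
    then show "ennreal (1 / snd z) * ennreal (snd z powr \<gamma>) = ennreal (snd z powr (\<gamma> - 1))"
      by (simp add: powr_diff flip: ennreal_mult')
  qed (intro borel_measurable_times_ennreal m1 m2)+
  finally show ?thesis .
qed

lemma borel_measurable_axb:
  "g \<in> borel_measurable borel \<Longrightarrow> g \<in> borel_measurable (axb_measure \<gamma> :: ((real ^ 'm) \<times> real) measure)"
  by (simp add: axb_measure_eq measurable_restrict_space1)

text \<open>This moves integrals to Lebesgue measure on the whole space, where Tonelli's theorem and
  box volumes are available.\<close>

lemma nn_integral_axb_measure:
  fixes g :: "(real ^ 'm) \<times> real \<Rightarrow> ennreal"
  assumes "g \<in> borel_measurable borel"
  shows "integral\<^sup>N (axb_measure \<gamma>) g
    = (\<integral>\<^sup>+z\<in>axb_group. ennreal (snd z powr (\<gamma> - 1)) * g z \<partial>lborel)"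
proof -
  have "(\<lambda>z. ennreal (snd z powr (\<gamma> - 1))) \<in> borel_measurable (restrict_space lborel axb_group)"
    by (rule borel_measurable_restrict_lborel) measurable
  moreover have "g \<in> borel_measurable (restrict_space lborel axb_group)"
    using assms by (intro borel_measurable_restrict_lborel) (simp add: borel_prod)
  ultimately show ?thesis
    unfolding axb_measure_eq
    by (subst nn_integral_density) (simp_all add: nn_integral_restrict_space)
qed

text \<open>Since n - 1 is \<open>CARD('m)\<close>, this is the case \<gamma> = 1 - n, with total
  exponent \<gamma> - 1 = -n; real and natural powers agree because a > 0.\<close>

lemma axb_measure_eq_left_haar:
  "(axb_measure (- real CARD('m)) :: ((real ^ 'm) \<times> real) measure) = axb_left_haar"
  unfolding axb_measure_eq axb_left_haar_def case_prod_beta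
proof (intro density_cong AE_I2)
  fix z :: "(real ^ 'm) \<times> real"
  assume "z \<in> space (restrict_space lborel axb_group)"
  then have "snd z > 0"
    by (auto simp: space_restrict_space axb_group_def)
  moreover have "- real CARD('m) - 1 = - real (CARD('m) + 1)"
    by simp
  ultimately show "ennreal (snd z powr (- real CARD('m) - 1)) = ennreal (1 / snd z ^ (CARD('m) + 1))"
    by (simp only: powr_minus_divide powr_realpow)
qed (rule borel_measurable_restrict_lborel; measurable)+

section \<open>Smoothness and gradient of the test function\<close>

text \<open>As tanh' = 1 - tanh^2, multiples of polynomials in tanh x_k are closed under directional
  derivatives. The polynomial \<open>[:1, 0, - 1:]\<close> is 1 - t^2, and the factor
  \<open>c\<close> absorbs the component of the direction.\<close>

lemma frechet_derivative_poly_tanh: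
  fixes Q :: "real poly" and z v :: "(real ^ 'm) \<times> real"
  shows "(\<lambda>z. c * poly Q (tanh (fst z $ k))) differentiable (at z)" (is ?D)
    and "frechet_derivative (\<lambda>z. c * poly Q (tanh (fst z $ k))) (at z) v
      = (c * fst v $ k) * poly (pderiv Q * [:1, 0, - 1:]) (tanh (fst z $ k))" (is ?E)
proof -
  have h: "((\<lambda>x. c * poly Q (tanh x)) has_field_derivative
      c * (poly (pderiv Q) (tanh x) * (1 - (tanh x)\<^sup>2))) (at x)" for x :: real
    by (auto intro!: derivative_eq_intros DERIV_chain'[where g = "poly Q"] poly_DERIV)
  have l: "((\<lambda>z :: (real ^ 'm) \<times> real. fst z $ k) has_derivative (\<lambda>v. fst v $ k)) (at z)"
    by (intro bounded_linear_imp_has_derivative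
        bounded_linear_compose[OF bounded_linear_vec_nth bounded_linear_fst])
  have "((\<lambda>z. c * poly Q (tanh (fst z $ k))) has_derivative
      (\<lambda>v. c * (poly (pderiv Q) (tanh (fst z $ k)) * (1 - (tanh (fst z $ k))\<^sup>2)) * fst v $ k)) (at z)"
    using has_derivative_compose[OF l h[of "fst z $ k", unfolded has_field_derivative_def]] by simp
  then have d: "((\<lambda>z. c * poly Q (tanh (fst z $ k))) has_derivative
      (\<lambda>v. (c * fst v $ k) * poly (pderiv Q * [:1, 0, - 1:]) (tanh (fst z $ k)))) (at z)"
    by (simp add: algebra_simps power2_eq_square)
  then show ?D
    unfolding differentiable_def by blast
  show ?E
    using frechet_derivative_at[OF d] by metis
qed

text \<open>Induction on the order of differentiability, for all \<open>c\<close> and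
  \<open>Q\<close> at once, since each derivative is again of this form.\<close>

lemma smooth_poly_tanh:
  "smooth_fun_on (\<lambda>z :: (real ^ 'm) \<times> real. c * poly Q (tanh (fst z $ k))) S"
proof -
  have "k_times_cont_diff_on j (\<lambda>z :: (real ^ 'm) \<times> real. c * poly Q (tanh (fst z $ k))) S" for j
  proof (induction j arbitrary: c Q)
    case 0
    show ?case
      by (auto intro!: differentiable_imp_continuous_on differentiable_at_withinI
            frechet_derivative_poly_tanh(1) simp only: differentiable_on_def k_times_cont_diff_on.simps)
  next
    case (Suc j)
    show ?case
      using Suc by (simp only: k_times_cont_diff_on.simps frechet_derivative_poly_tanh) simp
  qed
  then show ?thesis
    by (simp add: smooth_fun_on_def)
qed

lemma smooth_tanh_coord: "smooth_fun_on (\<lambda>z :: (real ^ 'm) \<times> real. tanh (fst z $ k)) S"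
  using smooth_poly_tanh[of 1 "[:0, 1:]"] by simp

text \<open>Only X_k contributes, because the function depends on x_k alone. The bound tanh^2 \<le>
  1 removes the absolute value left by the square root.\<close>

lemma axb_grad_norm_tanh_coord:
  fixes z :: "(real ^ 'm) \<times> real"
  shows "axb_grad_norm (\<lambda>z. tanh (fst z $ k)) z = \<bar>snd z\<bar> * (1 - (tanh (fst z $ k))\<^sup>2)"
proof -
  have d: "frechet_derivative (\<lambda>z. tanh (fst z $ k)) (at z) v
      = fst v $ k * (1 - (tanh (fst z $ k))\<^sup>2)" for v
    using frechet_derivative_poly_tanh(2)[of 1 "[:0, 1:]" k z v]
    by (simp add: pderiv_pCons algebra_simps power2_eq_square)
  have "(\<Sum>i\<in>UNIV. (axb_X i (\<lambda>z. tanh (fst z $ k)) z)\<^sup>2)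
      = (\<Sum>i\<in>UNIV. if i = k then (snd z * (1 - (tanh (fst z $ k))\<^sup>2))\<^sup>2 else 0)"
    by (intro sum.cong) (auto simp: axb_X_def d axis_def)
  moreover have "(tanh (fst z $ k))\<^sup>2 \<le> 1"
    using tanh_real_bounds[of "fst z $ k"] by (simp add: abs_square_le_1 abs_le_iff)
  ultimately show ?thesis
    by (simp add: axb_grad_norm_def axb_X0_def d abs_mult)
qed

section \<open>Upper bound for the gradient integral\<close>

text \<open>The left side is 1/cosh^2 x, and 4 |x| \<le> (1 + |x|)^2 \<le> 4 cosh^2 x. The true
  decay is exponential, but this rate suffices.\<close>

lemma one_minus_tanh_squared_le:
  fixes x \<rho> :: real
  assumes "0 < \<rho>" "\<rho> \<le> \<bar>x\<bar>"
  shows "1 - (tanh x)\<^sup>2 \<le> 1 / \<rho>"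
proof -
  have "1 + \<bar>x\<bar> \<le> 2 * cosh x"
  proof -
    have "1 + \<bar>x\<bar> \<le> exp \<bar>x\<bar>"
      by simp
    also have "\<dots> \<le> 2 * cosh \<bar>x\<bar>"
      by (simp add: cosh_field_def)
    finally show ?thesis by simp
  qed
  then have "(1 + \<bar>x\<bar>)\<^sup>2 \<le> (2 * cosh x)\<^sup>2"
    by (intro power_mono) auto
  moreover have "4 * \<bar>x\<bar> \<le> (1 + \<bar>x\<bar>)\<^sup>2"
    using zero_le_power2[of "1 - \<bar>x\<bar>"] by (simp add: power2_eq_square algebra_simps)
  ultimately have "\<rho> \<le> (cosh x)\<^sup>2"
    using assms by (simp add: power_mult_distrib)
  moreover have "1 - (tanh x)\<^sup>2 = 1 / (cosh x)\<^sup>2"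
    using hyperbolic_pythagoras[of x] cosh_real_pos[of x] by (simp add: tanh_def power_divide divide_simps)
  ultimately show ?thesis
    using assms by (simp add: frac_le)
qed

lemma emeasure_lborel_cbox_cart:
  fixes l u :: "real ^ 'm"
  assumes "\<And>i. l $ i \<le> u $ i"
  shows "emeasure lborel (cbox l u) = ennreal (\<Prod>i\<in>UNIV. u $ i - l $ i)"
proof -
  have "cbox l u \<noteq> {}"
    using assms by (auto simp: interval_ne_empty_cart)
  then show ?thesis
    using content_cbox_cart[of l u] emeasure_lborel_cbox_finite[of l u]
    by (simp add: emeasure_eq_ennreal_measure)
qed

text \<open>The ball is covered by a slab |x_k| \<le> \<rho>, where the integrand is at most 1, and
  the part of the cube with |x_k| > \<rho>, where it is at most 1/\<rho>. This gains a factor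
  R^(-1/2) over the order of the volume.\<close>

lemma nn_integral_one_minus_tanh_squared_le:
  fixes k :: "'m :: finite"
  assumes "R > 0"
  shows "(\<integral>\<^sup>+x\<in>{x :: real ^ 'm. norm x < R}. ennreal (1 - (tanh (x $ k))\<^sup>2) \<partial>lborel)
    \<le> ennreal (2 ^ (CARD('m) + 1) * R powr (real CARD('m) - 1 / 2))"
proof -
  \<comment> \<open>This width makes the two contributions equal: each is (2R)^d / \<rho> with d =
    \<open>CARD('m)\<close>.\<close>
  define \<rho> where "\<rho> = sqrt R"
  have \<rho>: "\<rho> > 0" "\<rho> * \<rho> = R"
    using assms by (auto simp: \<rho>_def)
  define slab :: "(real ^ 'm) set"
    where "slab = cbox (\<chi> i. if i = k then - \<rho> else - R) (\<chi> i. if i = k then \<rho> else R)"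
  define cube :: "(real ^ 'm) set" where "cube = cbox (\<chi> i. - R) (\<chi> i. R)"
  have eslab: "emeasure lborel slab = ennreal (2 * \<rho> * (2 * R) ^ (CARD('m) - 1))"
  proof -
    have "emeasure lborel slab = ennreal (\<Prod>i::'m\<in>UNIV. if i = k then 2 * \<rho> else 2 * R)"
      unfolding slab_def using assms \<rho>
      by (subst emeasure_lborel_cbox_cart) (auto intro!: arg_cong[where f = ennreal] prod.cong)
    also have "(\<Prod>i::'m\<in>UNIV. if i = k then 2 * \<rho> else 2 * R) = 2 * \<rho> * (2 * R) ^ (CARD('m) - 1)"
      by (subst prod.remove[of _ k]) (auto simp: prod_constant card_Diff_singleton)
    finally show ?thesis .
  qed
  have ecube: "emeasure lborel cube = ennreal ((2 * R) ^ CARD('m))"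
    unfolding cube_def using assms by (subst emeasure_lborel_cbox_cart) auto
  have "(\<integral>\<^sup>+x\<in>{x :: real ^ 'm. norm x < R}. ennreal (1 - (tanh (x $ k))\<^sup>2) \<partial>lborel)
    \<le> (\<integral>\<^sup>+x. indicator slab x + ennreal (1 / \<rho>) * indicator cube x \<partial>lborel)"
  proof (intro nn_integral_mono)
    fix x :: "real ^ 'm"
    show "ennreal (1 - (tanh (x $ k))\<^sup>2) * indicator {x. norm x < R} x
      \<le> indicator slab x + ennreal (1 / \<rho>) * indicator cube x"
    proof (cases "norm x < R")
      case True
      then have xi: "\<bar>x $ i\<bar> \<le> R" for i
        using component_le_norm_cart[of x i] by linarith
      then have xi': "- R \<le> x $ i" "x $ i \<le> R" for i
        by (auto simp: abs_le_iff minus_le_iff)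
      then have c: "x \<in> cube"
        by (auto simp: cube_def mem_box_cart)
      show ?thesis
      proof (cases "\<bar>x $ k\<bar> \<le> \<rho>")
        case True
        then have "x \<in> slab"
          using xi' by (auto simp: slab_def mem_box_cart)
        moreover have "ennreal (1 - (tanh (x $ k))\<^sup>2) \<le> 1"
          by (simp add: ennreal_le_1)
        ultimately show ?thesis
          using c by (auto simp: indicator_def intro: order_trans add_increasing2)
      next
        case False
        then have "ennreal (1 - (tanh (x $ k))\<^sup>2) \<le> ennreal (1 / \<rho>)"
          using \<rho> by (intro ennreal_leI one_minus_tanh_squared_le) auto
        then show ?thesis
          using c by (auto simp: indicator_def intro: add_increasing)
      qed
    qed simp
  qed
  also have "\<dots> = emeasure lborel slab + ennreal (1 / \<rho>) * emeasure lborel cube"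
    by (subst nn_integral_add) (auto simp: slab_def cube_def nn_integral_cmult)
  also have "\<dots> = ennreal (2 * \<rho> * (2 * R) ^ (CARD('m) - 1) + (1 / \<rho>) * (2 * R) ^ CARD('m))"
    using assms \<rho> unfolding eslab ecube by (simp add: ennreal_plus flip: ennreal_mult')
  also have "2 * \<rho> * (2 * R) ^ (CARD('m) - 1) + (1 / \<rho>) * (2 * R) ^ CARD('m)
    = 2 ^ (CARD('m) + 1) * R powr (real CARD('m) - 1 / 2)"
  proof -
    obtain d where d: "CARD('m) = Suc d"
      using zero_less_card_finite[where 'a = 'm] gr0_implies_Suc by blast
    have p: "R powr (real CARD('m) - 1 / 2) = R ^ CARD('m) / \<rho>"
      using assms by (simp add: powr_diff powr_realpow \<rho>_def powr_half_sqrt)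
    have "2 * \<rho> * (2 * R) ^ d = 2 * (2 * R) ^ d * R / \<rho>"
      using \<rho> by (simp add: field_simps)
    then show ?thesis
      unfolding p by (simp add: d power_mult_distrib)
  qed
  finally show ?thesis .
qed

text \<open>Dropping both subtracted terms of (e^r - a) (a - e^(-r)) leaves e^r a, the squared
  radius used for the slice at height a.\<close>

lemma axb_ball_norm_less:
  assumes "z \<in> axb_ball r"
  shows "(norm (fst z))\<^sup>2 < exp r * snd z"
proof -
  have "exp (- r) < snd z" "snd z < exp r"
    and n: "(norm (fst z))\<^sup>2 < (exp r - snd z) * (snd z - exp (- r))"
    using assms by (auto simp: axb_ball_eq)
  moreover have "0 < exp (- r)"
    by simp
  ultimately have "(exp r - snd z) * (snd z - exp (- r)) \<le> exp r * snd z"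
    by (intro mult_mono) linarith+
  with n show ?thesis by linarith
qed

lemma borel_measurable_tanh_coord:
  "(\<lambda>z :: (real ^ 'm) \<times> real. tanh (fst z $ k)) \<in> borel_measurable borel"
  by (intro borel_measurable_continuous_onI continuous_intros) (use cosh_real_nonzero in auto)

text \<open>Integrating over x first bounds the slice at height a by a multiple of e^(r (d/2 - 1/4))
  a^(\<beta> - 5/4). Here a^\<beta> \<le> e^(r |\<beta>|), and the integral of a^(-5/4) over a \<ge>
  e^(-r) is 4 e^(r/4), which cancels the loss of r/4 in the exponent.\<close>

lemma nn_integral_axb_grad_norm_tanh_le:
  fixes p \<gamma> r :: real and k :: "'m :: finite"
  assumes "p \<ge> 1"
  shows "(\<integral>\<^sup>+z\<in>axb_ball r. ennreal (axb_grad_norm (\<lambda>z. tanh (fst z $ k)) z powr p)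
        \<partial>(axb_measure \<gamma> :: ((real ^ 'm) \<times> real) measure))
    \<le> ennreal (2 ^ (CARD('m) + 3)
        * exp (r * (real CARD('m) / 2 + \<bar>\<gamma> + p + real CARD('m) / 2\<bar>)))"
proof -
  define d where "d = real CARD('m)"
  define \<beta> where "\<beta> = \<gamma> + p + d / 2"
  define s where "s = (\<lambda>x :: real ^ 'm. 1 - (tanh (x $ k))\<^sup>2)"
  \<comment> \<open>A majorant of the integrand: the slices of the ball are enlarged to Euclidean
    balls of radius sqrt (e^r a), and the power p of \<open>s\<close> is replaced by 1.\<close>
  define F where "F = (\<lambda>z :: (real ^ 'm) \<times> real. ennreal (snd z powr (\<gamma> + p - 1)) *
    indicator {exp (- r)<..<exp r} (snd z) *
    (ennreal (s (fst z)) * indicator {z. norm (fst z) < sqrt (exp r * snd z)} z))"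
  have s: "0 \<le> s x" "s x \<le> 1" for x
    using tanh_real_bounds[of "x $ k"] by (auto simp: s_def abs_square_le_1 abs_le_iff)
  have s_borel: "s \<in> borel_measurable borel"
    unfolding s_def
    by (intro borel_measurable_continuous_onI continuous_intros) (use cosh_real_nonzero in auto)
  have F_borel: "F \<in> borel_measurable (lborel \<Otimes>\<^sub>M lborel)"
    unfolding F_def using s_borel by measurable
  have grad: "axb_grad_norm (\<lambda>z. tanh (fst z $ k)) z = \<bar>snd z\<bar> * s (fst z)" for z
    by (simp add: axb_grad_norm_tanh_coord s_def)
  have "(\<lambda>z. ennreal ((\<bar>snd z\<bar> * s (fst z)) powr p) * indicator (axb_ball r) z)
      \<in> borel_measurable (borel \<Otimes>\<^sub>M borel)"
    using s_borel sets_axb_ball[where 'm = 'm, of r] unfolding borel_prod[symmetric] by measurable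
  then have "(\<integral>\<^sup>+z\<in>axb_ball r. ennreal ((\<bar>snd z\<bar> * s (fst z)) powr p) \<partial>axb_measure \<gamma>)
    = (\<integral>\<^sup>+z\<in>axb_group. ennreal (snd z powr (\<gamma> - 1))
        * (ennreal ((\<bar>snd z\<bar> * s (fst z)) powr p) * indicator (axb_ball r) z) \<partial>lborel)"
    by (intro nn_integral_axb_measure) (simp add: borel_prod)
  also have "\<dots> \<le> (\<integral>\<^sup>+z. F z \<partial>lborel)"
  proof (intro nn_integral_mono)
    fix z :: "(real ^ 'm) \<times> real"
    show "ennreal (snd z powr (\<gamma> - 1)) * (ennreal ((\<bar>snd z\<bar> * s (fst z)) powr p)
        * indicator (axb_ball r) z) * indicator axb_group z \<le> F z"
    proof (cases "z \<in> axb_ball r")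
      case True
      then have a: "exp (- r) < snd z" "snd z < exp r" "snd z > 0"
        by (auto dest: axb_ballD)
      have "sqrt ((norm (fst z))\<^sup>2) < sqrt (exp r * snd z)"
        using axb_ball_norm_less[OF True] by (intro real_sqrt_less_mono)
      then have x: "norm (fst z) < sqrt (exp r * snd z)"
        by simp
      \<comment> \<open>Here p \<ge> 1 enters, together with 0 \<le> s \<le> 1.\<close>
      have "s (fst z) powr p \<le> s (fst z) powr 1"
        using assms s[of "fst z"] by (intro powr_mono') auto
      then have "snd z powr (\<gamma> - 1) * (\<bar>snd z\<bar> * s (fst z)) powr p
        \<le> snd z powr (\<gamma> - 1) * (snd z powr p * s (fst z))"
        using a s[of "fst z"] by (intro mult_left_mono) (auto simp: powr_mult intro!: mult_left_mono)
      also have "\<dots> = snd z powr (\<gamma> + p - 1) * s (fst z)"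
        using a by (simp add: powr_add powr_diff)
      finally show ?thesis
        using True a x s[of "fst z"] axb_ball_subset_group
        by (auto simp: F_def indicator_def simp flip: ennreal_mult')
    qed simp
  qed
  also have "\<dots> = (\<integral>\<^sup>+a. \<integral>\<^sup>+x. F (x, a) \<partial>lborel \<partial>lborel)"
    using lborel_pair.nn_integral_snd[OF F_borel] by (simp add: lborel_prod)
  \<comment> \<open>The height range may be extended to the whole half-line, because -5/4 < -1;
    without the gain of R^(-1/2) the exponent would be -1.\<close>
  also have "\<dots> \<le> (\<integral>\<^sup>+a\<in>{exp (- r)..}. ennreal (2 ^ (CARD('m) + 1)
      * exp (r * (d / 2 - 1 / 4 + \<bar>\<beta>\<bar>)) * a powr (- 5 / 4)) \<partial>lborel)"
  proof (intro nn_integral_mono)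
    fix a :: real
    show "(\<integral>\<^sup>+x. F (x, a) \<partial>lborel) \<le> ennreal (2 ^ (CARD('m) + 1)
      * exp (r * (d / 2 - 1 / 4 + \<bar>\<beta>\<bar>)) * a powr (- 5 / 4)) * indicator {exp (- r)..} a"
    proof (cases "exp (- r) < a \<and> a < exp r")
      case True
      then have a: "a > 0"
        using exp_gt_zero[of "- r"] by linarith
      then have R: "sqrt (exp r * a) > 0"
        by simp
      have "(\<integral>\<^sup>+x. F (x, a) \<partial>lborel) = ennreal (a powr (\<gamma> + p - 1))
          * (\<integral>\<^sup>+x\<in>{x. norm x < sqrt (exp r * a)}. ennreal (s x) \<partial>lborel)"
        using True s_borel by (subst nn_integral_cmult[symmetric]) (auto simp: F_def indicator_def)
      also have "\<dots> \<le> ennreal (a powr (\<gamma> + p - 1))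
          * ennreal (2 ^ (CARD('m) + 1) * sqrt (exp r * a) powr (d - 1 / 2))"
        unfolding s_def d_def by (intro mult_left_mono nn_integral_one_minus_tanh_squared_le R) auto
      also have "\<dots> = ennreal (2 ^ (CARD('m) + 1)
          * (a powr (\<gamma> + p - 1) * sqrt (exp r * a) powr (d - 1 / 2)))"
        by (simp add: mult_ac flip: ennreal_mult')
      also have "\<dots> \<le> ennreal (2 ^ (CARD('m) + 1)
          * (exp (r * (d / 2 - 1 / 4 + \<bar>\<beta>\<bar>)) * a powr (- 5 / 4)))"
      proof (intro ennreal_leI mult_left_mono)
        have "\<bar>ln a\<bar> \<le> r"
          using True a ln_less_cancel_iff[of a "exp r"] ln_less_cancel_iff[of "exp (- r)" a]
          by (simp add: abs_le_iff)
        \<comment> \<open>Using |\<beta>| and |ln a| covers both signs of \<beta>: the extreme value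
          of a^\<beta> may lie at either end of the height range.\<close>
        then have "\<bar>\<beta>\<bar> * \<bar>ln a\<bar> \<le> \<bar>\<beta>\<bar> * r"
          by (intro mult_left_mono) auto
        then have "\<beta> * ln a \<le> \<bar>\<beta>\<bar> * r"
          using abs_ge_self[of "\<beta> * ln a"] unfolding abs_mult by linarith
        have e: "sqrt (exp r * a) = exp ((r + ln a) / 2)"
        proof (rule real_sqrt_unique)
          have "(exp ((r + ln a) / 2))\<^sup>2 = exp (r + ln a)"
            by (simp add: power2_eq_square flip: exp_add)
          then show "(exp ((r + ln a) / 2))\<^sup>2 = exp r * a"
            using a by (simp add: exp_add)
        qed simp
        have "a powr (\<gamma> + p - 1) * sqrt (exp r * a) powr (d - 1 / 2)
          = exp ((\<gamma> + p - 1) * ln a + (r + ln a) / 2 * (d - 1 / 2))"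
          using a unfolding e by (simp add: powr_def exp_add exp_powr_real)
        also have "(\<gamma> + p - 1) * ln a + (r + ln a) / 2 * (d - 1 / 2)
          = \<beta> * ln a + r * (d / 2 - 1 / 4) - 5 / 4 * ln a"
          by (simp add: \<beta>_def field_simps)
        also have "exp \<dots> \<le> exp (r * (d / 2 - 1 / 4 + \<bar>\<beta>\<bar>) - 5 / 4 * ln a)"
          using \<open>\<beta> * ln a \<le> \<bar>\<beta>\<bar> * r\<close> by (simp add: algebra_simps)
        also have "\<dots> = exp (r * (d / 2 - 1 / 4 + \<bar>\<beta>\<bar>)) * a powr (- 5 / 4)"
          using a by (simp add: powr_def flip: exp_add)
        finally show "a powr (\<gamma> + p - 1) * sqrt (exp r * a) powr (d - 1 / 2)
          \<le> exp (r * (d / 2 - 1 / 4 + \<bar>\<beta>\<bar>)) * a powr (- 5 / 4)" .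
      qed simp
      finally show ?thesis
        using True by (simp add: mult.assoc)
    qed (simp add: F_def)
  qed
  also have "\<dots> = ennreal (0 - 2 ^ (CARD('m) + 1) * exp (r * (d / 2 - 1 / 4 + \<bar>\<beta>\<bar>))
      * (- 4 * exp (- r) powr (- 1 / 4)))"
  proof (intro nn_integral_FTC_atLeast)
    fix a :: real assume "exp (- r) \<le> a"
    then have a: "a > 0"
      using exp_gt_zero[of "- r"] by linarith
    have "((\<lambda>a. - 4 * a powr (- 1 / 4)) has_real_derivative - 4 * (- 1 / 4 * a powr (- 1 / 4 - 1))) (at a)"
      using a by (intro DERIV_cmult has_real_derivative_powr)
    then show "((\<lambda>a. 2 ^ (CARD('m) + 1) * exp (r * (d / 2 - 1 / 4 + \<bar>\<beta>\<bar>)) * (- 4 * a powr (- 1 / 4)))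
      has_real_derivative 2 ^ (CARD('m) + 1) * exp (r * (d / 2 - 1 / 4 + \<bar>\<beta>\<bar>)) * a powr (- 5 / 4)) (at a)"
      by (intro DERIV_cmult) simp
  next
    have "((\<lambda>a. a powr (- 1 / 4)) \<longlongrightarrow> (0 :: real)) at_top"
      by (intro tendsto_neg_powr filterlim_ident) simp
    then show "((\<lambda>a. 2 ^ (CARD('m) + 1) * exp (r * (d / 2 - 1 / 4 + \<bar>\<beta>\<bar>)) * (- 4 * a powr (- 1 / 4)))
      \<longlongrightarrow> 0) at_top"
      by (intro tendsto_mult_right_zero)
  qed auto
  also have "0 - 2 ^ (CARD('m) + 1) * exp (r * (d / 2 - 1 / 4 + \<bar>\<beta>\<bar>)) * (- 4 * exp (- r) powr (- 1 / 4))
      = 2 ^ (CARD('m) + 3) * (exp (r * (d / 2 - 1 / 4 + \<bar>\<beta>\<bar>)) * exp (r / 4))"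
    by (simp add: exp_powr_real power_add)
  also have "exp (r * (d / 2 - 1 / 4 + \<bar>\<beta>\<bar>)) * exp (r / 4) = exp (r * (d / 2 + \<bar>\<beta>\<bar>))"
    unfolding exp_add[symmetric] by (simp add: algebra_simps)
  finally show ?thesis
    unfolding grad by (simp add: d_def \<beta>_def)
qed

section \<open>Lower bound for the distance to constants\<close>

lemma borel_measurable_indicator_abs_tanh_diff_powr:
  "(\<lambda>z :: (real ^ 'm) \<times> real. indicat_real (axb_ball r) z *\<^sub>R \<bar>tanh (fst z $ k) - c\<bar> powr p)
    \<in> borel_measurable borel"
  using borel_measurable_tanh_coord[of k] sets_axb_ball[where 'm = 'm, of r] by measurable

text \<open>The ball is bounded in the Euclidean sense. For \<gamma> \<le> 1 the density a^(\<gamma>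
  - 1) is nonincreasing, so on the ball it is at most its value at e^(-r); the function itself is at
  most (1 + |c|)^p.\<close>

lemma set_integrable_abs_tanh_diff_powr:
  fixes p \<gamma> c r :: real and k :: "'m :: finite"
  assumes "p \<ge> 0" "\<gamma> \<le> 1"
  shows "set_integrable (axb_measure \<gamma> :: ((real ^ 'm) \<times> real) measure) (axb_ball r)
    (\<lambda>z. \<bar>tanh (fst z $ k) - c\<bar> powr p)"
  unfolding set_integrable_def
proof (intro integrableI_bounded borel_measurable_axb)
  let ?f = "\<lambda>z :: (real ^ 'm) \<times> real. indicat_real (axb_ball r) z *\<^sub>R \<bar>tanh (fst z $ k) - c\<bar> powr p"
  show borel: "?f \<in> borel_measurable borel"
    by (rule borel_measurable_indicator_abs_tanh_diff_powr)
  have bdd: "bounded (axb_ball r :: ((real ^ 'm) \<times> real) set)"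
  proof (rule bounded_subset)
    show "bounded (ball (0 :: real ^ 'm) (exp r) \<times> {0..exp r})"
      by (intro bounded_Times bounded_ball bounded_closed_interval)
    show "axb_ball r \<subseteq> ball (0 :: real ^ 'm) (exp r) \<times> {0..exp r}"
    proof
      fix z :: "(real ^ 'm) \<times> real" assume z: "z \<in> axb_ball r"
      from axb_ballD[OF z] have a: "0 < snd z" "snd z < exp r"
        by auto
      then have "exp r * snd z \<le> (exp r)\<^sup>2"
        by (simp add: power2_eq_square)
      then have "(norm (fst z))\<^sup>2 < (exp r)\<^sup>2"
        using axb_ball_norm_less[OF z] by linarith
      then have "norm (fst z) < exp r"
        by (rule power_less_imp_less_base) simp
      with a show "z \<in> ball 0 (exp r) \<times> {0..exp r}"
        by (cases z) auto
    qed
  qed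
  have "(\<integral>\<^sup>+z. ennreal (norm (?f z)) \<partial>axb_measure \<gamma>)
    = (\<integral>\<^sup>+z\<in>axb_group. ennreal (snd z powr (\<gamma> - 1)) * ennreal (norm (?f z)) \<partial>lborel)"
    by (intro nn_integral_axb_measure measurable_compose[OF borel, of "\<lambda>t. ennreal (norm t)"])
      measurable
  also have "\<dots> \<le> (\<integral>\<^sup>+z. ennreal (exp (- r) powr (\<gamma> - 1) * (1 + \<bar>c\<bar>) powr p)
      * indicator (axb_ball r) z \<partial>(lborel :: ((real ^ 'm) \<times> real) measure))"
  proof (intro nn_integral_mono)
    fix z :: "(real ^ 'm) \<times> real"
    show "ennreal (snd z powr (\<gamma> - 1)) * ennreal (norm (?f z)) * indicator axb_group z
      \<le> ennreal (exp (- r) powr (\<gamma> - 1) * (1 + \<bar>c\<bar>) powr p) * indicator (axb_ball r) z"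
    proof (cases "z \<in> axb_ball r")
      case True
      then have "exp (- r) < snd z"
        by (rule axb_ballD)
      then have "snd z powr (\<gamma> - 1) \<le> exp (- r) powr (\<gamma> - 1)"
        using assms by (intro powr_mono2') auto
      moreover have "\<bar>tanh (fst z $ k) - c\<bar> \<le> 1 + \<bar>c\<bar>"
        using tanh_real_bounds[of "fst z $ k"] by auto
      then have "\<bar>tanh (fst z $ k) - c\<bar> powr p \<le> (1 + \<bar>c\<bar>) powr p"
        using assms by (intro powr_mono2) auto
      ultimately have "snd z powr (\<gamma> - 1) * \<bar>tanh (fst z $ k) - c\<bar> powr p
          \<le> exp (- r) powr (\<gamma> - 1) * (1 + \<bar>c\<bar>) powr p"
        by (intro mult_mono) auto
      then show ?thesis
        using True by (auto simp: indicator_def simp flip: ennreal_mult' intro!: ennreal_leI)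
    qed simp
  qed
  also have "\<dots> = ennreal (exp (- r) powr (\<gamma> - 1) * (1 + \<bar>c\<bar>) powr p)
      * emeasure lborel (axb_ball r :: ((real ^ 'm) \<times> real) set)"
    by (simp add: nn_integral_cmult_indicator)
  also have "\<dots> < \<infinity>"
    using emeasure_bounded_finite[OF bdd] by (simp add: ennreal_mult_less_top)
  finally show "(\<integral>\<^sup>+z. ennreal (norm (?f z)) \<partial>axb_measure \<gamma>) < \<infinity>" .
qed

text \<open>The mass comes from heights of order e^(-r): there the density is of order e^(-r
  (\<gamma> - 1)), and the height interval has length of order e^(-r). \<open>L\<close> is fixed
  before \<open>r\<close> and \<open>c\<close>, so that \<open>c\<close> may later be the average,
  which depends on \<open>r\<close>.\<close>

lemma integral_abs_tanh_diff_powr_ge: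
  fixes p \<gamma> r0 :: real and k :: "'m :: finite"
  assumes "p \<ge> 0" "\<gamma> \<le> 1" "r0 > 0"
  obtains L where "L > 0" "\<And>r c. r \<ge> r0 \<Longrightarrow> L * exp (- r * \<gamma>)
    \<le> (LINT z:axb_ball r|(axb_measure \<gamma> :: ((real ^ 'm) \<times> real) measure). \<bar>tanh (fst z $ k) - c\<bar> powr p)"
proof -
  \<comment> \<open>\<open>M\<close> is the ratio of the extreme heights e^r and e^(-r) at the
    smallest radius \<open>r0\<close>; \<open>u\<close> and \<open>v\<close> cut the interval from 1
    to \<open>M\<close> into thirds.\<close>
  define M where "M = exp (2 * r0)"
  define u v where "u = 1 + (M - 1) / 3" and "v = 1 + 2 * (M - 1) / 3"
  \<comment> \<open>\<open>q\<close> bounds from below the squared radius of every slice at a height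
    between u e^(-r) and v e^(-r).\<close>
  define q where "q = (1 - v / M) * (u - 1)"
  \<comment> \<open>With this choice |x_i| \<le> 2 \<epsilon> for all i gives |x|^2 \<le> q/4, hence
    a point inside the slice.\<close>
  define \<epsilon> where "\<epsilon> = sqrt (q / CARD('m)) / 4"
  \<comment> \<open>The factors bound the function and the density from below and give the volume of
    the box, with all powers of e^(-r) taken out; the density is smallest at the top height, hence
    \<open>v\<close>.\<close>
  define L where "L = tanh \<epsilon> powr p * v powr (\<gamma> - 1) * (\<epsilon> ^ CARD('m) * (v - u))"
  have M: "M > 1"
    using assms by (simp add: M_def)
  have uv: "1 < u" "u < v" "v < M"
    using M by (auto simp: u_def v_def field_simps)
  then have q: "q > 0"
    using M by (simp add: q_def)
  then have \<epsilon>: "\<epsilon> > 0"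
    by (simp add: \<epsilon>_def)
  have \<epsilon>q: "real CARD('m) * (2 * \<epsilon>)\<^sup>2 < q"
    using q by (simp add: \<epsilon>_def power_mult_distrib power_divide)
  have "L > 0"
    using \<epsilon> uv by (simp add: L_def)
  moreover have "L * exp (- r * \<gamma>)
    \<le> (LINT z:axb_ball r|(axb_measure \<gamma> :: ((real ^ 'm) \<times> real) measure). \<bar>tanh (fst z $ k) - c\<bar> powr p)"
    if r: "r \<ge> r0" for r c
  proof -
    let ?f = "\<lambda>z :: (real ^ 'm) \<times> real. indicat_real (axb_ball r) z *\<^sub>R \<bar>tanh (fst z $ k) - c\<bar> powr p"
    \<comment> \<open>On the box of the sign opposite to \<open>c\<close>, subtracting \<open>c\<close> only increases the absolute value.\<close>
    define Q :: "(real ^ 'm) set"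
      where "Q = (if c \<ge> 0 then cbox (\<chi> i. - 2 * \<epsilon>) (\<chi> i. - \<epsilon>) else cbox (\<chi> i. \<epsilon>) (\<chi> i. 2 * \<epsilon>))"
    define I where "I = {u * exp (- r)..v * exp (- r)}"
    have eQ: "emeasure lborel Q = ennreal (\<epsilon> ^ CARD('m))"
      unfolding Q_def using \<epsilon> by (auto simp: emeasure_lborel_cbox_cart)
    have eI: "emeasure lborel I = ennreal ((v - u) * exp (- r))"
      unfolding I_def using uv by (auto simp: algebra_simps)
    have "emeasure lborel (Q \<times> I) = emeasure (lborel \<Otimes>\<^sub>M lborel) (Q \<times> I)"
      by (simp add: lborel_prod)
    also have "\<dots> = emeasure lborel Q * emeasure lborel I"
      by (intro lborel.emeasure_pair_measure_Times) (auto simp: Q_def I_def)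
    finally have eQI: "emeasure lborel (Q \<times> I) = ennreal (\<epsilon> ^ CARD('m) * ((v - u) * exp (- r)))"
      using \<epsilon> uv unfolding eQ eI by (simp add: ennreal_mult')
    have QI_sets: "Q \<times> I \<in> sets lborel"
      unfolding Q_def I_def by (auto intro!: borel_closed closed_Times)
    have QI: "z \<in> axb_ball r" "v powr (\<gamma> - 1) * exp (- r * (\<gamma> - 1)) \<le> snd z powr (\<gamma> - 1)"
      "tanh \<epsilon> powr p \<le> \<bar>tanh (fst z $ k) - c\<bar> powr p" if z: "z \<in> Q \<times> I" for z
    proof -
      have a: "u * exp (- r) \<le> snd z" "snd z \<le> v * exp (- r)"
        using z by (auto simp: I_def)
      have xi: "\<epsilon> \<le> \<bar>fst z $ i\<bar>" "\<bar>fst z $ i\<bar> \<le> 2 * \<epsilon>" "fst z $ i * c \<le> 0" for i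
      proof -
        have "c \<ge> 0 \<and> - 2 * \<epsilon> \<le> fst z $ i \<and> fst z $ i \<le> - \<epsilon> \<or>
            c < 0 \<and> \<epsilon> \<le> fst z $ i \<and> fst z $ i \<le> 2 * \<epsilon>"
          using z by (cases "c \<ge> 0") (auto simp: Q_def mem_box_cart)
        then show "\<epsilon> \<le> \<bar>fst z $ i\<bar>" "\<bar>fst z $ i\<bar> \<le> 2 * \<epsilon>" "fst z $ i * c \<le> 0"
          using \<epsilon> by (auto simp: mult_le_0_iff)
      qed
      have er: "exp (- r) > 0" "exp r * exp (- r) = 1"
        by (simp_all flip: exp_add)
      have "exp (2 * r0) \<le> exp (2 * r)"
        using r by simp
      then have Mr: "M \<le> exp r * exp r"
        by (simp add: M_def flip: exp_add)
      \<comment> \<open>This is where r \<ge> r0 enters: the top height v e^(-r) stays a fixed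
        fraction below e^r.\<close>
      have "v / M * exp r \<ge> v * exp (- r)"
      proof -
        have "exp (- r) * M \<le> exp (- r) * (exp r * exp r)"
          using Mr by (intro mult_left_mono) auto
        also have "\<dots> = exp r"
          by (simp flip: exp_add)
        finally have "v * (exp (- r) * M) \<le> v * exp r"
          using uv by (intro mult_left_mono) auto
        then show ?thesis
          using M by (simp add: field_simps)
      qed
      then have a2: "(1 - v / M) * exp r \<le> exp r - snd z"
        using a by (simp add: algebra_simps)
      have pos: "0 < (1 - v / M) * exp r" "0 < (u - 1) * exp (- r)"
        using uv M by auto
      have a1: "(u - 1) * exp (- r) \<le> snd z - exp (- r)"
        using a by (simp add: algebra_simps)
      have "(norm (fst z))\<^sup>2 = (\<Sum>i\<in>UNIV. \<bar>fst z $ i\<bar>\<^sup>2)"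
        by (simp add: norm_vec_def L2_set_def sum_nonneg)
      also have "\<dots> \<le> (\<Sum>i::'m\<in>UNIV. (2 * \<epsilon>)\<^sup>2)"
        using xi by (intro sum_mono power_mono) auto
      also have "\<dots> < q"
        using \<epsilon>q by simp
      also have "q = ((1 - v / M) * exp r) * ((u - 1) * exp (- r))"
        using er by (simp add: q_def mult_ac)
      also have "\<dots> \<le> (exp r - snd z) * (snd z - exp (- r))"
        using a1 a2 pos by (intro mult_mono) linarith+
      finally have n: "(norm (fst z))\<^sup>2 < (exp r - snd z) * (snd z - exp (- r))" .
      show "z \<in> axb_ball r"
        using a1 a2 pos n by (auto simp: axb_ball_eq)
      have "0 < u * exp (- r)"
        using uv by simp
      then have "(v * exp (- r)) powr (\<gamma> - 1) \<le> snd z powr (\<gamma> - 1)"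
        using a assms by (intro powr_mono2') linarith+
      then show "v powr (\<gamma> - 1) * exp (- r * (\<gamma> - 1)) \<le> snd z powr (\<gamma> - 1)"
        using uv by (simp add: powr_mult exp_powr_real)
      have "tanh \<epsilon> \<le> \<bar>tanh (fst z $ k)\<bar>"
        using xi(1)[of k] tanh_real_le_iff[of \<epsilon> "\<bar>fst z $ k\<bar>"] by (simp add: tanh_real_abs)
      also have "\<dots> \<le> \<bar>tanh (fst z $ k) - c\<bar>"
        using xi(3)[of k] \<epsilon> xi(1)[of k]
        by (auto simp: mult_le_0_iff abs_if)
      finally show "tanh \<epsilon> powr p \<le> \<bar>tanh (fst z $ k) - c\<bar> powr p"
        using assms \<epsilon> by (intro powr_mono2) auto
    qed
    have "ennreal (L * exp (- r * \<gamma>))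
      = ennreal (tanh \<epsilon> powr p * (v powr (\<gamma> - 1) * exp (- r * (\<gamma> - 1)))) * emeasure lborel (Q \<times> I)"
    proof -
      have "exp (- r * \<gamma>) = exp (- r * (\<gamma> - 1)) * exp (- r)"
        unfolding exp_add[symmetric] by (simp add: algebra_simps)
      then show ?thesis
        using \<epsilon> uv unfolding eQI by (simp add: L_def mult_ac flip: ennreal_mult')
    qed
    also have "\<dots> = (\<integral>\<^sup>+z\<in>Q \<times> I. ennreal (tanh \<epsilon> powr p * (v powr (\<gamma> - 1) * exp (- r * (\<gamma> - 1)))) \<partial>lborel)"
      using QI_sets by (simp add: nn_integral_cmult_indicator)
    also have "\<dots> \<le> (\<integral>\<^sup>+z\<in>axb_group. ennreal (snd z powr (\<gamma> - 1)) * ennreal (?f z) \<partial>lborel)"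
    proof (intro nn_integral_mono)
      fix z :: "(real ^ 'm) \<times> real"
      show "ennreal (tanh \<epsilon> powr p * (v powr (\<gamma> - 1) * exp (- r * (\<gamma> - 1)))) * indicator (Q \<times> I) z
        \<le> ennreal (snd z powr (\<gamma> - 1)) * ennreal (?f z) * indicator axb_group z"
      proof (cases "z \<in> Q \<times> I")
        case True
        have "tanh \<epsilon> powr p * (v powr (\<gamma> - 1) * exp (- r * (\<gamma> - 1)))
          \<le> \<bar>tanh (fst z $ k) - c\<bar> powr p * snd z powr (\<gamma> - 1)"
          using QI(2,3)[OF True] by (intro mult_mono) auto
        then show ?thesis
          using True QI(1)[OF True] axb_ball_subset_group
          by (auto simp: indicator_def mult.commute simp flip: ennreal_mult' intro!: ennreal_leI)
      qed simp
    qed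
    also have "\<dots> = (\<integral>\<^sup>+z. ennreal (?f z) \<partial>axb_measure \<gamma>)"
      by (intro nn_integral_axb_measure[symmetric] measurable_compose[OF _ measurable_ennreal]
          borel_measurable_indicator_abs_tanh_diff_powr)
    \<comment> \<open>Integrability matters here: a Bochner integral is 0 by default when it
      diverges, which would defeat a lower bound.\<close>
    also have "\<dots> = ennreal (integral\<^sup>L (axb_measure \<gamma>) ?f)"
      using set_integrable_abs_tanh_diff_powr[OF assms(1,2), of r k c]
      unfolding set_integrable_def by (intro nn_integral_eq_integral) auto
    finally show ?thesis
      unfolding set_lebesgue_integral_def
      by (subst (asm) ennreal_le_iff) (auto intro!: Bochner_Integration.integral_nonneg)
  qed
  ultimately show thesis
    using that by blast
qed

section \<open>Lower bound for the Poincare constant\<close>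

text \<open>The exponent is that of the lower bound for the left-hand side, -r \<gamma>, minus that
  of the upper bound for the gradient integral.\<close>

lemma poincare_constant_ge:
  fixes p \<gamma> r0 :: real and C :: "real \<Rightarrow> real"
  assumes "p \<ge> 1" "\<gamma> \<le> 1" "r0 > 0"
    and poincare: "\<And>r (f :: (real ^ 'm) \<times> real \<Rightarrow> real).
      r > 0 \<Longrightarrow> smooth_fun_on f axb_group \<Longrightarrow>
      (LINT z:axb_ball r|axb_measure \<gamma>. \<bar>f z - axb_avg \<gamma> r f\<bar> powr p)
        \<le> C r * (LINT z:axb_ball r|axb_measure \<gamma>. axb_grad_norm f z powr p)"
  shows "\<exists>K>0. \<forall>r\<ge>r0. C r \<ge>
    K * exp (r * (- \<gamma> - real CARD('m) / 2 - \<bar>\<gamma> + p + real CARD('m) / 2\<bar>))"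
proof -
  \<comment> \<open>Any coordinate direction serves; one exists because n \<ge> 2.\<close>
  fix k :: 'm
  let ?f = "\<lambda>z :: (real ^ 'm) \<times> real. tanh (fst z $ k)"
  let ?M = "axb_measure \<gamma> :: ((real ^ 'm) \<times> real) measure"
  define e where "e = real CARD('m) / 2 + \<bar>\<gamma> + p + real CARD('m) / 2\<bar>"
  define U :: real where "U = 2 ^ (CARD('m) + 3)"
  obtain L where L: "L > 0" "\<And>r c. r \<ge> r0 \<Longrightarrow> L * exp (- r * \<gamma>)
    \<le> (LINT z:axb_ball r|?M. \<bar>?f z - c\<bar> powr p)"
  proof (rule integral_abs_tanh_diff_powr_ge[of p \<gamma> r0 k])
    show "p \<ge> 0"
      using assms(1) by simp
  qed (use assms(2,3) in auto)
  have "L / U * exp (r * (- \<gamma> - real CARD('m) / 2 - \<bar>\<gamma> + p + real CARD('m) / 2\<bar>)) \<le> C r"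
    if "r \<ge> r0" for r
  proof -
    define G where "G = (LINT z:axb_ball r|?M. axb_grad_norm ?f z powr p)"
    have G: "0 \<le> G"
      unfolding G_def set_lebesgue_integral_def by (intro Bochner_Integration.integral_nonneg) auto
    have "(\<integral>\<^sup>+z. ennreal (indicat_real (axb_ball r) z * axb_grad_norm ?f z powr p) \<partial>?M)
      = (\<integral>\<^sup>+z\<in>axb_ball r. ennreal (axb_grad_norm ?f z powr p) \<partial>?M)"
      by (intro nn_integral_cong) (auto simp: indicator_def)
    also have "\<dots> \<le> ennreal (U * exp (r * e))"
      unfolding U_def e_def by (rule nn_integral_axb_grad_norm_tanh_le[OF assms(1)])
    \<comment> \<open>An upper bound passes to the Bochner integral in every case, its default value
      0 being below the bound.\<close>
    finally have GU: "G \<le> U * exp (r * e)"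
      unfolding G_def set_lebesgue_integral_def
      by (intro integral_real_bounded) (auto simp: U_def)
    have CG: "L * exp (- r * \<gamma>) \<le> C r * G"
      unfolding G_def
    proof (rule order_trans)
      show "L * exp (- r * \<gamma>) \<le> (LINT z:axb_ball r|?M. \<bar>?f z - axb_avg \<gamma> r ?f\<bar> powr p)"
        by (rule L(2)[OF that])
      show "(LINT z:axb_ball r|?M. \<bar>?f z - axb_avg \<gamma> r ?f\<bar> powr p)
          \<le> C r * (LINT z:axb_ball r|?M. axb_grad_norm ?f z powr p)"
        using assms(3) that by (intro poincare smooth_tanh_coord) simp
    qed
    \<comment> \<open>The sign of \<open>C r\<close> is not assumed. Strict positivity of the
      left-hand side of the inequality forces it, and only then may \<open>G\<close> be replaced by
      its upper bound.\<close>
    have "0 < C r * G"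
      using L(1) by (intro less_le_trans[OF _ CG]) simp
    then have "C r \<ge> 0"
      using G by (simp add: zero_less_mult_iff)
    then have "L * exp (- r * \<gamma>) \<le> C r * (U * exp (r * e))"
      using CG mult_left_mono[OF GU] by (meson order_trans)
    moreover have "U > 0"
      by (simp add: U_def)
    ultimately have "L / U * (exp (- r * \<gamma>) / exp (r * e)) \<le> C r"
      by (simp add: field_simps)
    moreover have "exp (- r * \<gamma>) / exp (r * e) =
        exp (r * (- \<gamma> - real CARD('m) / 2 - \<bar>\<gamma> + p + real CARD('m) / 2\<bar>))"
      by (simp add: e_def algebra_simps flip: exp_diff)
    ultimately show ?thesis by (simp only:)
  qed
  moreover have "L / U > 0"
    using L(1) by (simp add: U_def)
  ultimately show ?thesis by blast
qed

text \<open>The constant \<open>K\<close> is uniform on r \<ge> r0 for each r0 > 0. A positive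
  constant for all r > 0 at once cannot be expected, as Poincare constants of small balls may tend
  to 0 with the radius.\<close>

theorem mainTheorem2:
  fixes p \<gamma> :: real and n :: nat and C :: "real \<Rightarrow> real"
  assumes "p \<ge> 1"
    and "n = CARD('m::finite) + 1"
    and poincare: "\<And>r (f :: (real ^ 'm) \<times> real \<Rightarrow> real).
      r > 0 \<Longrightarrow> smooth_fun_on f axb_group \<Longrightarrow>
      (LINT z:axb_ball r|axb_measure \<gamma>. \<bar>f z - axb_avg \<gamma> r f\<bar> powr p)
        \<le> C r * (LINT z:axb_ball r|axb_measure \<gamma>. axb_grad_norm f z powr p)"
  shows
    "(\<gamma> < - ((p + real n - 1) / 2) \<longrightarrow>
        \<bar>\<gamma> + (p + real n - 1) / 2\<bar> + (p + real n - 1) / 2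
          > \<bar>\<gamma> + p + (real n - 1) / 2\<bar> + (real n - 1) / 2 \<and>
        (\<forall>r0>0. \<exists>K>0. \<forall>r\<ge>r0.
          C r \<ge> K * exp (r * (\<bar>\<gamma> + (p + real n - 1) / 2\<bar> + p / 2
                              - \<bar>\<gamma> + p + (real n - 1) / 2\<bar>))))
     \<and>
     (\<gamma> = - real n + 1 \<and> real n > p + 1 \<longrightarrow>
        (axb_measure \<gamma> :: ((real ^ 'm) \<times> real) measure) = axb_left_haar \<and>
        (\<forall>r0>0. \<exists>K>0. \<forall>r\<ge>r0.
          C r \<ge> K * exp ((\<bar>(- real n + p + 1) / 2\<bar> - \<bar>(- real n + 1) / 2 + p\<bar> + p / 2) * r) \<and>
          (real n \<ge> 2 * p + 1 \<longrightarrow>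
             K * exp ((\<bar>(- real n + p + 1) / 2\<bar> - \<bar>(- real n + 1) / 2 + p\<bar> + p / 2) * r)
               = K * exp (p * r)) \<and>
          (p + 1 < real n \<and> real n \<le> 2 * p + 1 \<longrightarrow>
             K * exp ((\<bar>(- real n + p + 1) / 2\<bar> - \<bar>(- real n + 1) / 2 + p\<bar> + p / 2) * r)
               = K * exp ((real n - p - 1) * r))))"
proof -
  have d: "real CARD('m) = real n - 1"
    using assms(2) by simp
  have bound: "\<exists>K>0. \<forall>r\<ge>r0. C r \<ge> K * exp (r * (\<bar>\<gamma> + (p + real n - 1) / 2\<bar> + p / 2
      - \<bar>\<gamma> + p + (real n - 1) / 2\<bar>))"
    if "\<gamma> < - ((p + real n - 1) / 2)" "r0 > 0" for r0
  proof -
    \<comment> \<open>The threshold for \<gamma> is negative, because p \<ge> 1 and n \<ge>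
      2.\<close>
    have "\<gamma> \<le> 1"
      using that(1) assms(1,2) by (simp add: field_simps)
    moreover have "\<bar>\<gamma> + (p + real n - 1) / 2\<bar> + p / 2 = - \<gamma> - real CARD('m) / 2"
      using that(1) unfolding d by (simp add: field_simps)
    ultimately show ?thesis
      using poincare_constant_ge[OF assms(1) _ that(2) poincare] by (simp add: d)
  qed
  \<comment> \<open>The left side equals -\<gamma>. The right side is either -\<gamma> - p or
    \<gamma> + p + n - 1; the first is smaller since p > 0, the second by the bound on
    \<gamma>.\<close>
  have "\<bar>\<gamma> + (p + real n - 1) / 2\<bar> + (p + real n - 1) / 2
      > \<bar>\<gamma> + p + (real n - 1) / 2\<bar> + (real n - 1) / 2"
    if "\<gamma> < - ((p + real n - 1) / 2)"
    using that assms(1) by (auto simp: abs_if field_simps)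
  moreover have "(axb_measure \<gamma> :: ((real ^ 'm) \<times> real) measure) = axb_left_haar"
    if "\<gamma> = - real n + 1"
    using axb_measure_eq_left_haar[where 'm = 'm] that by (simp add: d)
  moreover have "\<exists>K>0. \<forall>r\<ge>r0.
      C r \<ge> K * exp ((\<bar>(- real n + p + 1) / 2\<bar> - \<bar>(- real n + 1) / 2 + p\<bar> + p / 2) * r)"
    if "\<gamma> = - real n + 1" "real n > p + 1" "r0 > 0" for r0
  proof -
    \<comment> \<open>For \<gamma> = 1 - n this is equivalent to n > p + 1, so the second claim is
      an instance of the first.\<close>
    have "\<gamma> < - ((p + real n - 1) / 2)"
      using that by (simp add: field_simps)
    moreover have "\<gamma> + (p + real n - 1) / 2 = (- real n + p + 1) / 2"
      "\<gamma> + p + (real n - 1) / 2 = (- real n + 1) / 2 + p"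
      using that by (simp_all add: field_simps)
    moreover have swap: "r * (a + b - c) = (a - c + b) * r" for a b c r :: real
      by (simp add: algebra_simps)
    ultimately show ?thesis
      using bound[OF _ that(3)] by (simp only: swap)
  qed
  \<comment> \<open>The two cases differ by the sign of (1 - n)/2 + p, which changes at n = 2p + 1;
    there both exponents equal p.\<close>
  moreover have "\<bar>(- real n + p + 1) / 2\<bar> - \<bar>(- real n + 1) / 2 + p\<bar> + p / 2 = p"
    if "real n \<ge> 2 * p + 1"
    using that assms(1) by (simp add: abs_if field_simps)
  moreover have "\<bar>(- real n + p + 1) / 2\<bar> - \<bar>(- real n + 1) / 2 + p\<bar> + p / 2 = real n - p - 1"
    if "p + 1 < real n" "real n \<le> 2 * p + 1"
    using that by (simp add: abs_if field_simps)
  ultimately show ?thesis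
    using bound by (simp only: simp_thms) metis
qed

end
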